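(* For all $n\ge 2$, \[\left|\mathrm{Av}_n[\overline{23}14]\right|=\sum_{i=0}^{n-2}\binom{n-2}{i}A_i,\] where $A_i$ is the number of strongly monotone partitions of $[i]$ (with $A_0=1$).
   Context: For $\sigma\in S_n$, the cyclic permutation $[\sigma]$ is the set of all rotations of $\sigma$; $[S_n]$ is the set of cyclic permutations of length $n$. $[\sigma]$ contains the vincular pattern $[\overline{23}14]$ if some rotation of $\sigma$ has entries $a,b,c,d$ appearing in this order with $a,b$ adjacent and $c<a<b<d$; $\mathrm{Av}_n[\overline{23}14]$ is the set of $[\sigma]\in[S_n]$ not containing it. A set partition of $[i]$ is strongly monotone if, when its blocks are sorted so that their minimum elements are increasing, their maximum elements are also increasing. *)

theory Defs
  imports Main "HOL-Library.Disjoint_Sets"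
begin

definition perms :: "nat \<Rightarrow> nat list set" where
  "perms n = {xs. distinct xs \<and> set xs = {1..n}}"

definition cyc_class :: "nat list \<Rightarrow> nat list set" where
  "cyc_class xs = {rotate k xs | k. k < length xs}"

definition cyclic_perms :: "nat \<Rightarrow> nat list set set" where
  "cyclic_perms n = cyc_class ` perms n"

definition contains_23_1_4 :: "nat list \<Rightarrow> bool" where
  "contains_23_1_4 xs \<longleftrightarrow> (\<exists>p q r. p + 1 < q \<and> q < r \<and> r < length xs \<and>
      xs ! q < xs ! p \<and> xs ! p < xs ! (p + 1) \<and> xs ! (p + 1) < xs ! r)"

definition cyc_contains_23_1_4 :: "nat list set \<Rightarrow> bool" where
  "cyc_contains_23_1_4 C \<longleftrightarrow> (\<exists>xs \<in> C. contains_23_1_4 xs)"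

definition Av_23_1_4 :: "nat \<Rightarrow> nat list set set" where
  "Av_23_1_4 n = {C \<in> cyclic_perms n. \<not> cyc_contains_23_1_4 C}"

definition strongly_monotone :: "nat set set \<Rightarrow> bool" where
  "strongly_monotone P \<longleftrightarrow> (\<forall>B1\<in>P. \<forall>B2\<in>P. Min B1 < Min B2 \<longrightarrow> Max B1 < Max B2)"

definition A_sm :: "nat \<Rightarrow> nat" where
  "A_sm i = card {P. partition_on {1..i} P \<and> strongly_monotone P}"

end

theory Submission
  imports Defs
begin

text \<open>
  Rotate a cyclic permutation to \<open>1 X n Y\<close>.  An ascent inside \<open>Y\<close> followed by \<open>1\<close> and \<open>n\<close> is
  an occurrence of the pattern, so \<open>Y\<close> decreases; an ascent \<open>a < b\<close> inside \<open>X\<close> can be completed by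
  \<open>n\<close> on one side and by \<open>1\<close> on the other, so every later entry of \<open>X\<close> exceeds \<open>a\<close> and every
  earlier one is below \<open>b\<close>.  These conditions are also sufficient, hence the entries of \<open>X\<close> form an
  arbitrary subset of \<open>{2..n-1}\<close>.  Cutting such an \<open>X\<close> into its maximal descending runs, the
  condition on ascents says exactly that the minima and the maxima of the runs increase, that is,
  that the runs are the blocks of a strongly monotone partition.
\<close>

section \<open>Rotation classes\<close>

lemma cyc_class_eq_range:
  assumes "xs \<noteq> []"
  shows "cyc_class xs = range (\<lambda>k. rotate k xs)"
proof -
  have "rotate k xs \<in> cyc_class xs" for k
    using assms unfolding cyc_class_def
    by (auto intro!: exI[of _ "k mod length xs"] simp: rotate_conv_mod[of k])
  then show ?thesis
    by (auto simp: cyc_class_def)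
qed

text \<open>Trades rotation amounts for cuts of the word, so that later arguments can solve append
  equations instead of doing modular arithmetic.\<close>

lemma cyc_class_eq_splits:
  assumes "xs \<noteq> []"
  shows "cyc_class xs = {v @ u | u v. xs = u @ v}"
proof -
  have "\<exists>u v. xs = u @ v \<and> rotate k xs = v @ u" for k
    by (metis append_take_drop_id rotate_drop_take)
  moreover have "v @ u \<in> range (\<lambda>k. rotate k (u @ v))" for u v :: "nat list"
    by (metis rangeI rotate_append)
  ultimately show ?thesis
    unfolding cyc_class_eq_range[OF assms] by blast
qed

lemma cyc_class_rotate: "cyc_class (rotate m xs) = cyc_class xs"
proof (cases "xs = []")
  case False
  have "rotate k xs \<in> range (\<lambda>k. rotate k (rotate m xs))" for k
  proof -
    let ?l = "length xs"
    \<comment> \<open>Rotating by \<open>?l - m mod ?l\<close> completes the full turn begun by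
      \<open>m\<close>, so \<open>k\<close> further steps act on the original word.\<close>
    have "(k + (?l - m mod ?l) + m) mod ?l = (k + ((?l - m mod ?l) + m mod ?l)) mod ?l"
      by (metis add.assoc mod_add_right_eq)
    also have "\<dots> = k mod ?l"
      using False by (simp add: less_imp_le)
    finally have "rotate (k + (?l - m mod ?l)) (rotate m xs) = rotate k xs"
      by (metis rotate_conv_mod rotate_rotate)
    then show ?thesis
      by (metis rangeI)
  qed
  then show ?thesis
    using False by (auto simp: cyc_class_eq_range rotate_rotate)
qed simp

lemma cyc_class_append_commute: "cyc_class (v @ u) = cyc_class (u @ v)"
  by (metis cyc_class_rotate rotate_append)

lemma self_in_cyc_class: "xs \<noteq> [] \<Longrightarrow> xs \<in> cyc_class xs"
  by (auto simp: cyc_class_eq_splits)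

text \<open>By distinctness \<open>x\<close> occurs once, so only the trivial rotation starts with
  \<open>x\<close>. Fixing the first entry therefore selects a unique representative of a
  class.\<close>

lemma cyc_class_Cons_inject:
  assumes "distinct (x # xs)" "cyc_class (x # xs) = cyc_class (x # ys)"
  shows "xs = ys"
proof -
  have "x # ys \<in> cyc_class (x # xs)"
    using assms(2) self_in_cyc_class[of "x # ys"] by simp
  then obtain u v where uv: "x # xs = u @ v" "x # ys = v @ u"
    by (auto simp: cyc_class_eq_splits)
  show ?thesis
  proof (cases "u = [] \<or> v = []")
    case False
    then have "x \<in> set u" "x \<in> set v"
      using uv by (auto simp: Cons_eq_append_conv)
    then show ?thesis
      using assms(1) uv(1) by (metis distinct_append disjoint_iff)
  qed (use uv in auto)
qed

text \<open>Only rotations starting at the entry playing the role of \<open>2\<close> need to be inspected.\<close>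

lemma cyc_avoids_iff:
  assumes "xs \<noteq> []"
  shows "\<not> cyc_contains_23_1_4 (cyc_class xs) \<longleftrightarrow>
    (\<forall>a b ys. a # b # ys \<in> cyc_class xs \<longrightarrow> a < b \<longrightarrow> sorted_wrt (\<lambda>c d. \<not> (c < a \<and> b < d)) ys)"
    (is "?L \<longleftrightarrow> ?R")
proof
  assume L: ?L
  show ?R
  proof (intro allI impI)
    fix a b ys assume ab: "a # b # ys \<in> cyc_class xs" "a < b"
    show "sorted_wrt (\<lambda>c d. \<not> (c < a \<and> b < d)) ys"
    proof (rule ccontr)
      assume "\<not> ?thesis"
      then obtain i j where "i < j" "j < length ys" "ys ! i < a" "b < ys ! j"
        by (auto simp: sorted_wrt_iff_nth_less)
      then have "contains_23_1_4 (a # b # ys)"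
        unfolding contains_23_1_4_def using ab(2)
        by (intro exI[of _ 0] exI[of _ "i + 2"] exI[of _ "j + 2"]) auto
      then show False
        using L ab(1) by (auto simp: cyc_contains_23_1_4_def)
    qed
  qed
next
  assume R: ?R
  show ?L
  proof
    assume "cyc_contains_23_1_4 (cyc_class xs)"
    then obtain ys p q r where ys: "ys \<in> cyc_class xs" "p + 1 < q" "q < r" "r < length ys"
      "ys ! q < ys ! p" "ys ! p < ys ! (p + 1)" "ys ! (p + 1) < ys ! r"
      unfolding cyc_contains_23_1_4_def contains_23_1_4_def by blast
    \<comment> \<open>Rotation by \<open>p\<close> brings the ascent to the front and leaves
      \<open>t\<close> behind it. Since \<open>q\<close> and \<open>r\<close> lie beyond
      \<open>p + 1\<close>, their entries keep their order and sit in \<open>t\<close> at positions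
      lowered by \<open>p + 2\<close>.\<close>
    define t where "t = drop (p + 2) ys @ take p ys"
    have "ys ! p # ys ! (p + 1) # t = drop p ys @ take p ys"
      using ys by (simp add: t_def Cons_nth_drop_Suc[symmetric])
    also have "\<dots> = rotate p ys"
      using ys by (simp add: rotate_drop_take)
    also have "\<dots> \<in> cyc_class xs"
      using ys(1) assms by (auto simp: cyc_class_eq_range rotate_rotate)
    finally have "sorted_wrt (\<lambda>c d. \<not> (c < ys ! p \<and> ys ! (p + 1) < d)) t"
      using R ys by blast
    moreover have "t ! (q - (p + 2)) = ys ! q" "t ! (r - (p + 2)) = ys ! r"
      "q - (p + 2) < r - (p + 2)" "r - (p + 2) < length t"
      using ys by (auto simp: t_def nth_append simp del: add_2_eq_Suc')
    ultimately show False
      using ys by (metis (no_types, lifting) sorted_wrt_iff_nth_less)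
  qed
qed

section \<open>Words with tame ascents\<close>

text \<open>The condition on \<open>X\<close> in a class of \<open>1 X n Y\<close>: the bound on
  \<open>v\<close> excludes completions whose largest entry is \<open>n\<close>, the bound on
  \<open>u\<close> those whose smallest entry is \<open>1\<close>.\<close>

definition tame_ascents :: "nat list \<Rightarrow> bool" where
  "tame_ascents xs \<longleftrightarrow> (\<forall>u a b v. xs = u @ a # b # v \<longrightarrow> a < b \<longrightarrow>
     (\<forall>c\<in>set v. a < c) \<and> (\<forall>d\<in>set u. d < b))"

definition tame_words :: "nat set \<Rightarrow> nat list set" where
  "tame_words S = {xs. distinct xs \<and> set xs = S \<and> tame_ascents xs}"

lemma finite_tame_words:
  assumes "finite S"
  shows "finite (tame_words S)"
proof (rule finite_subset)
  show "tame_words S \<subseteq> {xs. set xs \<subseteq> S \<and> length xs \<le> card S}"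
    by (auto simp: tame_words_def distinct_card)
  show "finite {xs. set xs \<subseteq> S \<and> length xs \<le> card S}"
    using assms by (rule finite_lists_length_le)
qed

lemma tame_ascents_ConsD: "tame_ascents (x # xs) \<Longrightarrow> tame_ascents xs"
  unfolding tame_ascents_def by (metis append_Cons list.set_intros(2))

text \<open>Tameness only compares entries, so it survives order-preserving relabelling. This makes
  the number of tame words on \<open>S\<close> depend on \<open>card S\<close> alone.\<close>

lemma tame_ascents_map_iff:
  assumes "strict_mono_on (set xs) f"
  shows "tame_ascents (map f xs) \<longleftrightarrow> tame_ascents xs"
proof -
  have less: "f x < f y \<longleftrightarrow> x < y" if "x \<in> set xs" "y \<in> set xs" for x y
    using strict_mono_on_less[OF assms that] .
  show ?thesis
  proof
    assume L: "tame_ascents (map f xs)"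
    show "tame_ascents xs"
      unfolding tame_ascents_def
    proof (intro allI impI)
      fix u a b v assume xs: "xs = u @ a # b # v" and "a < b"
      then show "(\<forall>c\<in>set v. a < c) \<and> (\<forall>d\<in>set u. d < b)"
        using L[unfolded tame_ascents_def, rule_format, of "map f u" "f a" "f b" "map f v"]
        by (auto simp: less)
    qed
  next
    assume R: "tame_ascents xs"
    show "tame_ascents (map f xs)"
      unfolding tame_ascents_def
    proof (intro allI impI)
      fix u' a' b' v' assume eq: "map f xs = u' @ a' # b' # v'" and "a' < b'"
      then obtain u a b v where xs: "xs = u @ a # b # v"
        and eqs: "u' = map f u" "a' = f a" "b' = f b" "v' = map f v"
        by (auto simp: map_eq_append_conv map_eq_Cons_conv)
      have "a < b"
        using \<open>a' < b'\<close> less[of a b] unfolding eqs xs by simp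
      then have "(\<forall>c\<in>set v. a < c) \<and> (\<forall>d\<in>set u. d < b)"
        using R xs unfolding tame_ascents_def by blast
      then show "(\<forall>c\<in>set v'. a' < c) \<and> (\<forall>d\<in>set u'. d < b')"
        unfolding eqs using less xs by simp
    qed
  qed
qed

lemma card_tame_words_image:
  assumes "strict_mono_on S f"
  shows "card (tame_words (f ` S)) = card (tame_words S)"
proof -
  have inj: "inj_on f S"
    using assms by (rule strict_mono_on_imp_inj_on)
  have "tame_words (f ` S) = map f ` tame_words S"
  proof (intro equalityI subsetI)
    fix ys assume ys: "ys \<in> tame_words (f ` S)"
    define xs where "xs = map (inv_into S f) ys"
    have "map f xs = ys"
      unfolding xs_def map_map
      by (rule map_idI) (use ys in \<open>auto simp: tame_words_def f_inv_into_f\<close>)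
    moreover have "set xs = S"
      using ys inj by (auto simp: xs_def tame_words_def image_image inv_into_f_f)
    moreover have "distinct xs"
      using ys calculation by (auto simp: tame_words_def distinct_map)
    ultimately show "ys \<in> map f ` tame_words S"
      using ys assms tame_ascents_map_iff[of xs f] by (auto simp: tame_words_def)
  next
    fix ys assume "ys \<in> map f ` tame_words S"
    then show "ys \<in> tame_words (f ` S)"
      using assms inj by (auto simp: tame_words_def distinct_map tame_ascents_map_iff)
  qed
  moreover have "inj_on (map f) (tame_words S)"
    by (rule inj_onI) (use inj in \<open>auto simp: tame_words_def dest: map_inj_on\<close>)
  ultimately show ?thesis
    by (simp add: card_image)
qed

lemma card_tame_words_initial_segment:
  assumes "finite S"
  shows "card (tame_words S) = card (tame_words {1..card S})"
proof -
  \<comment> \<open>The increasing enumeration of \<open>S\<close> by \<open>1, ..., card S\<close>;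
    the shift by one is due to list positions starting at \<open>0\<close>.\<close>
  define f where "f = (\<lambda>k. sorted_list_of_set S ! (k - 1))"
  have "strict_mono_on {1..card S} f"
    unfolding f_def using strict_sorted_list_of_set[of S]
    by (auto intro!: strict_mono_onI simp: sorted_wrt_iff_nth_less)
  moreover have "f ` {1..card S} = S"
  proof -
    have "f ` {1..card S} = (!) (sorted_list_of_set S) ` {..<card S}"
      unfolding f_def image_Suc_lessThan[symmetric] image_image by simp
    also have "\<dots> = set (sorted_list_of_set S)"
      by (auto simp: set_conv_nth)
    finally show ?thesis
      using assms by simp
  qed
  ultimately show ?thesis
    using card_tame_words_image by metis
qed

section \<open>Descending runs and strongly monotone partitions\<close>

text \<open>In a decreasing run \<open>hd\<close> is the maximum and \<open>last\<close> the
  minimum, so this is a strongly monotone partition with each block written decreasingly and the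
  blocks listed by increasing minimum. It mediates between words (concatenate the runs) and
  partitions (forget the orders).\<close>

definition run_lists :: "nat set \<Rightarrow> nat list list set" where
  "run_lists S = {Ds. (\<forall>D\<in>set Ds. D \<noteq> [] \<and> sorted_wrt (>) D) \<and>
     sorted_wrt (\<lambda>D E. hd D < hd E \<and> last D < last E) Ds \<and> distinct (concat Ds) \<and> set (concat Ds) = S}"

lemma decreasing_hd_last:
  fixes D :: "nat list"
  assumes "D \<noteq> []" "sorted_wrt (>) D"
  shows "Max (set D) = hd D" "Min (set D) = last D" "last D \<le> hd D"
proof -
  have "x \<le> hd D \<and> last D \<le> x" if "x \<in> set D" for x
    using assms that by (induction D) (auto simp: less_imp_le)
  then show "Max (set D) = hd D" "Min (set D) = last D" "last D \<le> hd D"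
    using assms(1) by (auto intro!: Max_eqI Min_eqI)
qed

lemma decreasing_unique:
  fixes D :: "nat list"
  assumes "sorted_wrt (>) D"
  shows "D = rev (sorted_list_of_set (set D))"
proof -
  have "sorted_wrt (<) (rev D)"
    using assms by (simp add: sorted_wrt_rev)
  then show ?thesis
    by (metis rev_rev_ident set_rev sorted_list_of_set.idem_if_sorted_distinct strict_sorted_iff)
qed

section \<open>Concatenated runs and tame words\<close>

lemma ascent_in_concat_is_run_hd:
  fixes Ds :: "nat list list"
  assumes "\<forall>D\<in>set Ds. D \<noteq> [] \<and> sorted_wrt (>) D" "concat Ds = u @ a # b # v" "a < b"
  shows "b \<in> hd ` set Ds"
  using assms
proof (induction Ds arbitrary: u)
  case (Cons D Ds)
  have rest: "b \<in> hd ` set Ds" if "concat Ds = w @ a # b # v" for w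
    using Cons that by auto
  from Cons.prems(2) consider
      t where "D = u @ t" "t @ concat Ds = a # b # v"
    | t where "u = D @ t" "concat Ds = t @ a # b # v"
    by (auto simp: append_eq_append_conv2)
  then show ?case
  proof cases
    case 1
    \<comment> \<open>The ascent lies beyond \<open>D\<close>, straddles the end of
      \<open>D\<close>, or lies inside \<open>D\<close>; the last case contradicts that
      \<open>D\<close> decreases.\<close>
    then consider "t = []" | "t = [a]" "concat Ds = b # v" | s where "t = a # b # s"
      by (auto simp: append_eq_Cons_conv)
    then show ?thesis
    proof cases
      case 2
      then obtain E Es where "Ds = E # Es"
        by (cases Ds) auto
      moreover have "E \<noteq> []"
        using Cons.prems(1) calculation by auto
      ultimately show ?thesis
        using 2 by (cases E) auto
    qed (use 1 rest[of "[]"] Cons.prems in \<open>auto simp: sorted_wrt_append\<close>)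
  next
    case 2
    then show ?thesis using rest by force
  qed
qed simp

lemma run_lists_Cons_iff:
  "D # Ds \<in> run_lists S \<longleftrightarrow> D \<noteq> [] \<and> sorted_wrt (>) D \<and>
     (\<forall>E\<in>set Ds. hd D < hd E \<and> last D < last E) \<and> distinct D \<and>
     set D \<inter> set (concat Ds) = {} \<and> S = set D \<union> set (concat Ds) \<and>
     Ds \<in> run_lists (set (concat Ds))"
  unfolding run_lists_def by auto

lemma run_lists_ConsD:
  assumes "D # Ds \<in> run_lists S"
  shows "D \<noteq> []" "sorted_wrt (>) D" "Ds \<in> run_lists (set (concat Ds))"
    "\<And>E. E \<in> set Ds \<Longrightarrow> hd D < hd E \<and> last D < last E"
  using assms by (simp_all add: run_lists_Cons_iff)

text \<open>The entry \<open>x\<close> lies in a later run \<open>E\<close>, whose minimum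
  \<open>last E\<close> already exceeds \<open>last D\<close>.\<close>

lemma run_lists_concat_gt:
  assumes "D # Ds \<in> run_lists S" "x \<in> set (concat Ds)"
  shows "last D < x"
proof -
  obtain E where E: "E \<in> set Ds" "x \<in> set E"
    using assms(2) by auto
  then have "E \<noteq> []" "sorted_wrt (>) E" "last D < last E"
    using assms(1) by (auto simp: run_lists_def)
  then show ?thesis
    using decreasing_hd_last(2)[of E] E(2) by (metis List.finite_set Min_le order_less_le_trans)
qed

text \<open>An ascent joins the minimum \<open>a\<close> of one run to the maximum \<open>b\<close>
  of the next. Increasing minima put all later entries above \<open>a\<close>, and increasing maxima
  put all earlier entries below \<open>b\<close>. The induction peels off the first run.\<close>

lemma tame_ascents_concat:
  assumes "Ds \<in> run_lists S"
  shows "tame_ascents (concat Ds)"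
  using assms
proof (induction Ds arbitrary: S)
  case Nil
  then show ?case by (simp add: tame_ascents_def)
next
  case (Cons D Ds)
  note D = run_lists_ConsD[OF Cons.prems]
  have le_hd: "x \<le> hd D" if "x \<in> set D" for x
    using decreasing_hd_last(1)[OF D(1,2)] that by (metis List.finite_set Max_ge)
  show ?case
    unfolding tame_ascents_def
  proof (intro allI impI)
    fix u a b v assume eq: "concat (D # Ds) = u @ a # b # v" and ab: "a < b"
    \<comment> \<open>Either way \<open>b\<close> opens a run of \<open>Ds\<close>, and its head
      exceeds \<open>hd D\<close>. The second disjunct covers an ascent straddling the end of
      \<open>D\<close>.\<close>
    have hd_less: "hd D < b" if "concat Ds = w @ a # b # v \<or> concat Ds = b # v" for w
    proof -
      have "b \<in> hd ` set Ds"
      proof (cases "concat Ds = b # v")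
        case True
        then obtain E Es where "Ds = E # Es" "E \<noteq> []"
          using D(3) by (cases Ds) (auto simp: run_lists_def)
        then show ?thesis
          using True by (cases E) auto
      next
        case False
        then show ?thesis
          using that ab D(3) ascent_in_concat_is_run_hd[of Ds w a b v] by (auto simp: run_lists_def)
      qed
      then show ?thesis
        using D(4) by auto
    qed
    have rest: "(\<forall>c\<in>set v. a < c) \<and> (\<forall>d\<in>set u. d < b)" if "u = D @ w" "concat Ds = w @ a # b # v" for w
    proof -
      have "(\<forall>c\<in>set v. a < c) \<and> (\<forall>d\<in>set w. d < b)"
        using that(2) Cons.IH[OF D(3)] ab unfolding tame_ascents_def by blast
      then show ?thesis
        using that hd_less[of w] le_hd by fastforce
    qed
    from eq consider
        t where "D = u @ t" "t @ concat Ds = a # b # v"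
      | t where "u = D @ t" "concat Ds = t @ a # b # v"
      by (auto simp: append_eq_append_conv2)
    then show "(\<forall>c\<in>set v. a < c) \<and> (\<forall>d\<in>set u. d < b)"
    proof cases
      case 1
      then consider "t = []" | "t = [a]" "concat Ds = b # v" | s where "t = a # b # s"
        by (auto simp: append_eq_Cons_conv)
      then show ?thesis
      proof cases
        case 2
        have "a < c" if "c \<in> set v" for c
          using run_lists_concat_gt[OF Cons.prems, of c] 1 2 that by auto
        moreover have "d < b" if "d \<in> set u" for d
          using le_hd[of d] hd_less 1 2 that by force
        ultimately show ?thesis by blast
      qed (use 1 rest[of "[]"] D(2) ab in \<open>auto simp: sorted_wrt_append\<close>)
    next
      case 2
      then show ?thesis using rest by blast
    qed
  qed
qed

text \<open>A run can be neither shorter nor longer than the corresponding one in another decomposition,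
  since consecutive runs are separated by an ascent.\<close>

lemma inj_on_concat_run_lists: "inj_on concat (run_lists S)"
proof -
  have aux: "length D \<le> length E"
    if run: "D # Ds \<in> run_lists S'" "E # Es \<in> run_lists S'" and eq: "concat (D # Ds) = concat (E # Es)"
    for D E Ds Es S'
  proof (rule ccontr)
    assume "\<not> ?thesis"
    \<comment> \<open>The entry \<open>x\<close> follows the prefix \<open>E\<close> within the
      decreasing run \<open>D\<close>, hence is below \<open>last E\<close>; it also belongs to the
      later runs \<open>Es\<close>, hence is above \<open>last E\<close>.\<close>
    then obtain x t where t: "D = E @ x # t" "x # t @ concat Ds = concat Es"
      using eq by (auto simp: append_eq_append_conv2 Cons_eq_append_conv neq_Nil_conv)
    then have "last E < x"
      using run_lists_concat_gt[OF run(2), of x] by (metis list.set_intros(1))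
    moreover have "x < last E"
      using run_lists_ConsD(1)[OF run(2)] run_lists_ConsD(2)[OF run(1)] t(1)
      by (auto simp: sorted_wrt_append)
    ultimately show False by simp
  qed
  have "Ds = Es" if "Ds \<in> run_lists S" "Es \<in> run_lists S" "concat Ds = concat Es" for Ds Es S
    using that
  proof (induction Ds arbitrary: Es S)
    case Nil
    then show ?case by (cases Es) (auto simp: run_lists_def)
  next
    case (Cons D Ds)
    obtain E Fs where Es: "Es = E # Fs"
      using run_lists_ConsD(1)[OF Cons.prems(1)] Cons.prems(3) by (cases Es) auto
    have "length D = length E"
      using aux[OF Cons.prems[unfolded Es]]
        aux[OF Cons.prems(2)[unfolded Es] Cons.prems(1) Cons.prems(3)[unfolded Es, symmetric]]
      by (rule antisym)
    then have "D = E" "concat Ds = concat Fs"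
      using Cons.prems(3) Es by auto
    moreover have "Ds = Fs"
    proof (rule Cons.IH)
      show "Ds \<in> run_lists (set (concat Ds))"
        using run_lists_ConsD(3) Cons.prems(1) .
      show "Fs \<in> run_lists (set (concat Ds))"
        using run_lists_ConsD(3)[of E Fs S] Cons.prems(2) Es calculation(2) by simp
      show "concat Ds = concat Fs" by fact
    qed
    ultimately show ?case
      using Es by simp
  qed
  then show ?thesis
    by (auto intro: inj_onI)
qed

text \<open>Build the runs from the right: a new first letter \<open>x\<close> is prepended to the
  first run if it exceeds the head \<open>y\<close> of that run, and otherwise forms a run of its
  own.\<close>

lemma tame_word_in_concat_image:
  assumes "distinct xs" "tame_ascents xs"
  shows "\<exists>Ds\<in>run_lists (set xs). concat Ds = xs"
  using assms
proof (induction xs)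
  case Nil
  then show ?case by (auto simp: run_lists_def)
next
  case (Cons x xs)
  then obtain Ds where Ds: "Ds \<in> run_lists (set xs)" "concat Ds = xs"
    using tame_ascents_ConsD by auto
  show ?case
  proof (cases Ds)
    case Nil
    then show ?thesis
      using Ds by (intro bexI[of _ "[[x]]"]) (auto simp: run_lists_def)
  next
    case (Cons D Es)
    note D = run_lists_ConsD[OF Ds(1)[unfolded Cons]]
    obtain y D' where y: "D = y # D'"
      using D(1) by (cases D) auto
    have "x \<noteq> y"
      using Cons.prems(1) Ds(2) Cons y by auto
    then consider "y < x" | "x < y" by linarith
    then show ?thesis
    proof cases
      case 1
      \<comment> \<open>Now \<open>x\<close> replaces \<open>y\<close> as the first maximum. The
        ascent from \<open>last D\<close> to the head of the next run \<open>F\<close> bounds all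
        earlier entries, \<open>x\<close> included, by \<open>hd F\<close>, and later heads are
        larger still.\<close>
      have "x < hd E" if "E \<in> set Es" for E
      proof -
        obtain F Fs where F: "Es = F # Fs"
          using \<open>E \<in> set Es\<close> by (cases Es) auto
        note F' = run_lists_ConsD[OF D(3)[unfolded F]]
        have "last D < hd F"
          using D(4)[of F] F decreasing_hd_last(3)[OF F'(1,2)] by auto
        moreover have "D = butlast D @ [last D]" "F = hd F # tl F"
          using D(1) F'(1) by simp_all
        then have "x # xs = (x # butlast D) @ last D # hd F # (tl F @ concat Fs)"
          using Ds(2) Cons F
          by (metis append.assoc append_Cons append_Nil concat.simps(2))
        ultimately have "x < hd F"
          using Cons.prems(2) unfolding tame_ascents_def by (metis list.set_intros(1))
        then show ?thesis
          using F'(4)[of E] that F by auto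
      qed
      moreover have "sorted_wrt (>) (x # D)"
        using D(2) 1 y by auto
      moreover have "distinct (x # D)" "set (x # D) \<inter> set (concat Es) = {}"
        "set (x # xs) = set (x # D) \<union> set (concat Es)"
        using Cons.prems(1) Ds(2)[symmetric] Cons by auto
      ultimately have "(x # D) # Es \<in> run_lists (set (x # xs))"
        unfolding run_lists_Cons_iff[of "x # D"] using D(1,3,4) by auto
      moreover have "concat ((x # D) # Es) = x # xs"
        using Ds(2) Cons by simp
      ultimately show ?thesis by blast
    next
      case 2
      \<comment> \<open>Here \<open>x < y\<close> is an ascent at the very front, so tameness puts
        \<open>x\<close> below everything after it.\<close>
      have "x < z" if "z \<in> set xs" for z
        using Cons.prems(2)[unfolded tame_ascents_def, rule_format, of "[]" x y "D' @ concat Es"] that Ds(2) Cons y 2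
        by auto
      moreover have "last E \<in> set xs \<and> hd E \<in> set xs" if "E \<in> set Ds" for E
      proof -
        have "E \<noteq> []" "set E \<subseteq> set xs"
          using that Ds by (auto simp: run_lists_def)
        then show ?thesis by auto
      qed
      ultimately have "[x] # Ds \<in> run_lists (set (x # xs))"
        unfolding run_lists_Cons_iff[of "[x]"] using Ds Cons.prems(1) by auto
      moreover have "concat ([x] # Ds) = x # xs"
        using Ds(2) by simp
      ultimately show ?thesis by blast
    qed
  qed
qed

lemma bij_betw_concat_run_lists: "bij_betw concat (run_lists S) (tame_words S)"
proof -
  have "concat ` run_lists S = tame_words S"
  proof (intro equalityI subsetI)
    fix xs assume "xs \<in> concat ` run_lists S"
    then show "xs \<in> tame_words S"
      using tame_ascents_concat by (auto simp: tame_words_def) (auto simp: run_lists_def)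
  next
    fix xs assume "xs \<in> tame_words S"
    then show "xs \<in> concat ` run_lists S"
      using tame_word_in_concat_image[of xs] by (auto simp: tame_words_def)
  qed
  then show ?thesis
    using inj_on_concat_run_lists by (simp add: bij_betw_def)
qed

section \<open>Run lists and strongly monotone partitions\<close>

lemma run_lists_comparable:
  assumes "Ds \<in> run_lists S" "D \<in> set Ds" "E \<in> set Ds"
  shows "D = E \<or> (hd D < hd E \<and> last D < last E) \<or> (hd E < hd D \<and> last E < last D)"
proof -
  obtain i j where "i < length Ds" "j < length Ds" "D = Ds ! i" "E = Ds ! j"
    using assms(2,3) by (auto simp: in_set_conv_nth)
  then show ?thesis
    using assms(1) by (cases i j rule: linorder_cases) (auto simp: run_lists_def sorted_wrt_iff_nth_less)
qed

lemma run_lists_partition: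
  assumes "Ds \<in> run_lists S"
  shows "partition_on S (set ` set Ds)" "strongly_monotone (set ` set Ds)"
proof -
  show "partition_on S (set ` set Ds)"
  proof (rule partition_onI)
    fix B C assume "B \<in> set ` set Ds" "C \<in> set ` set Ds" "B \<noteq> C"
    moreover have "set D \<inter> set E = {}" if "D \<in> set Ds" "E \<in> set Ds" "D \<noteq> E" for D E
      using assms that by (simp add: run_lists_def distinct_concat_iff)
    ultimately show "disjnt B C"
      by (fastforce simp: disjnt_def)
  qed (use assms in \<open>auto simp: run_lists_def\<close>)
  show "strongly_monotone (set ` set Ds)"
    unfolding strongly_monotone_def
  proof (intro ballI impI)
    fix B C assume "B \<in> set ` set Ds" "C \<in> set ` set Ds" and less: "Min B < Min C"
    then obtain D E where DE: "D \<in> set Ds" "B = set D" "E \<in> set Ds" "C = set E"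
      by auto
    moreover have "D \<noteq> []" "sorted_wrt (>) D" "E \<noteq> []" "sorted_wrt (>) E"
      using assms DE by (auto simp: run_lists_def)
    ultimately show "Max B < Max C"
      using run_lists_comparable[OF assms DE(1,3)] less by (auto simp: decreasing_hd_last)
  qed
qed

text \<open>A block determines its run, being its decreasing arrangement, and the increasing last
  entries determine the order of the runs.\<close>

lemma inj_on_run_lists_blocks: "inj_on (\<lambda>Ds. set ` set Ds) (run_lists S)"
proof (rule inj_onI)
  fix Ds Es assume Ds: "Ds \<in> run_lists S" and Es: "Es \<in> run_lists S"
    and eq: "set ` set Ds = set ` set Es"
  have runs: "set Fs = (\<lambda>B. rev (sorted_list_of_set B)) ` set ` set Fs" if "Fs \<in> run_lists S" for Fs
  proof -
    have "rev (sorted_list_of_set (set D)) = D" if "D \<in> set Fs" for D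
      using that \<open>Fs \<in> run_lists S\<close> decreasing_unique[of D] by (auto simp: run_lists_def)
    then show ?thesis
      by (force simp: image_image)
  qed
  have same: "set Ds = set Es"
    using runs[OF Ds] runs[OF Es] eq by simp
  have "sorted_wrt (<) (map last Fs)" if "Fs \<in> run_lists S" for Fs
    using that by (auto simp: run_lists_def sorted_wrt_map elim: sorted_wrt_mono_rel[rotated])
  then have "map last Ds = map last Es"
    using Ds Es same by (intro strict_sorted_equal) auto
  moreover have "inj_on last (set Ds \<union> set Es)"
    using same run_lists_comparable[OF Ds] by (fastforce intro: inj_onI)
  ultimately show "Ds = Es"
    by (rule map_inj_on)
qed

text \<open>Insert the blocks by increasing minimum. Strong monotonicity makes the maximum of the
  new block the largest as well, so its decreasing arrangement can be appended as the last
  run.\<close>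

lemma strongly_monotone_runs:
  assumes "finite P" "\<And>B. B \<in> P \<Longrightarrow> finite B \<and> B \<noteq> {}" "disjoint P" "strongly_monotone P"
  shows "\<exists>Ds\<in>run_lists (\<Union>P). set ` set Ds = P"
  using assms
proof (induction P rule: finite_ranking_induct[where f = Min])
  case empty
  then show ?case by (auto simp: run_lists_def)
next
  case (insert B P)
  show ?case
  proof (cases "B \<in> P")
    case True
    then show ?thesis
      using insert by (simp add: insert_absorb)
  next
    case False
    obtain Ds where Ds: "Ds \<in> run_lists (\<Union>P)" "set ` set Ds = P"
      using insert by (auto simp: strongly_monotone_def pairwise_insert)
    define D where "D = rev (sorted_list_of_set B)"
    have B: "finite B" "B \<noteq> {}"
      using insert.prems(1) by auto
    have D: "set D = B" "D \<noteq> []" "sorted_wrt (>) D" "distinct D"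
      using B by (auto simp: D_def sorted_wrt_rev)
    have disj: "B \<inter> C = {}" if "C \<in> P" for C
      using that False insert.prems(2) by (auto simp: pairwise_insert disjnt_def)
    have "hd E < hd D \<and> last E < last D" if "E \<in> set Ds" for E
    proof -
      have C: "set E \<in> P"
        using that Ds(2) by auto
      have E: "E \<noteq> []" "sorted_wrt (>) E"
        using that Ds(1) by (auto simp: run_lists_def)
      \<comment> \<open>The ranking only yields \<open>Min (set E) \<le> Min B\<close>; equality
        would give two disjoint blocks a common element.\<close>
      have "Min (set E) \<in> set E" "Min B \<in> B"
        using E B by auto
      then have "Min (set E) < Min B"
        using disj[OF C] insert.hyps(2)[OF C] by (metis disjoint_iff order_le_imp_less_or_eq)
      moreover have "Max (set E) < Max B"
        using insert.prems(3) C calculation by (auto simp: strongly_monotone_def)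
      ultimately show ?thesis
        using decreasing_hd_last[OF E] decreasing_hd_last[OF D(2,3)] D(1) by simp
    qed
    moreover have "set D \<inter> \<Union>P = {}"
      using disj D(1) by blast
    ultimately have "Ds @ [D] \<in> run_lists (\<Union>(insert B P))"
      using Ds(1) D by (auto simp: run_lists_def sorted_wrt_append)
    moreover have "set ` set (Ds @ [D]) = insert B P"
      using Ds(2) D(1) by auto
    ultimately show ?thesis by blast
  qed
qed

lemma card_strongly_monotone:
  assumes "finite S"
  shows "card {P. partition_on S P \<and> strongly_monotone P} = card (tame_words S)"
proof -
  have "(\<lambda>Ds. set ` set Ds) ` run_lists S = {P. partition_on S P \<and> strongly_monotone P}"
  proof (intro equalityI subsetI)
    fix P assume "P \<in> {P. partition_on S P \<and> strongly_monotone P}"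
    then have P: "partition_on S P" "strongly_monotone P" by auto
    then have "finite B \<and> B \<noteq> {}" if "B \<in> P" for B
      using that assms by (auto simp: partition_on_def intro: finite_subset)
    then obtain Ds where "Ds \<in> run_lists (\<Union>P)" "set ` set Ds = P"
      using strongly_monotone_runs[of P] P finite_elements[OF assms P(1)]
      by (auto simp: partition_on_def)
    then show "P \<in> (\<lambda>Ds. set ` set Ds) ` run_lists S"
      using P(1) by (auto simp: partition_on_def)
  qed (auto simp: run_lists_partition)
  then have "card {P. partition_on S P \<and> strongly_monotone P} = card (run_lists S)"
    using card_image[OF inj_on_run_lists_blocks, of S] by simp
  then show ?thesis
    using bij_betw_same_card[OF bij_betw_concat_run_lists] by simp
qed

lemma card_tame_words:
  assumes "finite S"
  shows "card (tame_words S) = A_sm (card S)"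
  unfolding A_sm_def card_strongly_monotone[OF finite_atLeastAtMost]
  by (rule card_tame_words_initial_segment[OF assms])

section \<open>Normal form of avoiding classes\<close>

lemma not_decreasing_ascent:
  fixes xs :: "nat list"
  assumes "distinct xs" "\<not> sorted_wrt (>) xs"
  obtains u a b v where "xs = u @ a # b # v" "a < b"
proof -
  have "\<not> (\<forall>i. Suc i < length xs \<longrightarrow> xs ! i > xs ! Suc i)"
    using assms(2) sorted_wrt_iff_nth_Suc_transp[OF transp_on_greater, of xs] by blast
  then obtain i where i: "Suc i < length xs" "xs ! i \<le> xs ! Suc i"
    by (auto simp: not_less)
  moreover have "xs ! i \<noteq> xs ! Suc i"
    using i(1) assms(1) by (simp add: nth_eq_iff_index_eq)
  moreover have "xs = take i xs @ xs ! i # xs ! Suc i # drop (Suc (Suc i)) xs"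
    using i(1) by (metis Cons_nth_drop_Suc Suc_lessD append_take_drop_id)
  ultimately show thesis
    using that by (metis le_neq_implies_less)
qed

text \<open>For sufficiency, go through the cyclic ascents \<open>a < b\<close>: if
  \<open>a = 1\<close> or \<open>b = n\<close>, no entry is small or large enough to complete the
  pattern; a decreasing \<open>Y\<close> contains no ascent; ascents inside \<open>X\<close> are
  controlled by tameness.\<close>

lemma cyc_avoids_normal_form_iff:
  assumes dist: "distinct (X @ Y)" and n: "1 < n" and bounds: "\<And>x. x \<in> set X \<union> set Y \<Longrightarrow> 1 < x \<and> x < n"
  shows "\<not> cyc_contains_23_1_4 (cyc_class (1 # X @ n # Y)) \<longleftrightarrow> tame_ascents X \<and> sorted_wrt (>) Y"
    (is "?L \<longleftrightarrow> ?R")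
proof
  assume avoids: ?L
  have L: "sorted_wrt (\<lambda>c d. \<not> (c < a \<and> b < d)) ys"
    if "1 # X @ n # Y = u @ v" "v @ u = a # b # ys" "a < b" for u v a b ys
  proof -
    have "a # b # ys \<in> cyc_class (1 # X @ n # Y)"
      unfolding cyc_class_eq_splits[OF list.distinct(2)] using that(1) that(2)[symmetric] by blast
    then show ?thesis
      using avoids that(3) unfolding cyc_avoids_iff[OF list.distinct(2)] by blast
  qed
  have "sorted_wrt (>) Y"
  proof (rule ccontr)
    assume "\<not> ?thesis"
    then obtain u a b v where Y: "Y = u @ a # b # v" "a < b"
      using not_decreasing_ascent[of Y] dist by (metis distinct_append)
    then show False
      using L[of "1 # X @ n # u" "a # b # v" a b "v @ 1 # X @ n # u"] bounds[of a] bounds[of b]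
      by (auto simp: sorted_wrt_append)
  qed
  moreover have "tame_ascents X"
    unfolding tame_ascents_def
  proof (intro allI impI)
    fix u a b v assume X: "X = u @ a # b # v" "a < b"
    \<comment> \<open>Reading on from the ascent, \<open>n\<close> comes after all of
      \<open>v\<close> and \<open>1\<close> before all of \<open>u\<close>. This yields weak bounds,
      which distinctness makes strict.\<close>
    have sorted: "sorted_wrt (\<lambda>c d. \<not> (c < a \<and> b < d)) (v @ n # Y @ 1 # u)"
      using L[of "1 # u" "a # b # v @ n # Y" a b "v @ n # Y @ 1 # u"] X by simp
    have inner: "1 < a" "b < n"
      using bounds[of a] bounds[of b] X(1) by auto
    have "a \<notin> set v" "b \<notin> set u"
      using dist X(1) by auto
    moreover have "a \<le> c" if "c \<in> set v" for c
      using sorted that inner by (simp add: sorted_wrt_append not_less)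
    moreover have "d \<le> b" if "d \<in> set u" for d
      using sorted that inner by (simp add: sorted_wrt_append not_less)
    ultimately show "(\<forall>c\<in>set v. a < c) \<and> (\<forall>d\<in>set u. d < b)"
      by (metis le_neq_implies_less)
  qed
  ultimately show ?R by simp
next
  assume R: ?R
  show ?L
    unfolding cyc_avoids_iff[OF list.distinct(2)[of 1 "X @ n # Y"]]
  proof (intro allI impI)
    fix a b ys
    assume "a # b # ys \<in> cyc_class (1 # X @ n # Y)" and ab: "a < b"
    then obtain u v where uv: "1 # X @ n # Y = u @ v" "v @ u = a # b # ys"
      by (auto simp: cyc_class_eq_splits)
    then have "set (a # b # ys) = set (1 # X @ n # Y)"
      by (metis set_append Un_commute)
    then have range: "1 \<le> x \<and> x \<le> n" if "x \<in> set (a # b # ys)" for x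
      using that bounds n by fastforce
    have free: "sorted_wrt (\<lambda>c d. \<not> (c < a \<and> b < d)) zs"
      if "\<And>c d. c \<in> set zs \<Longrightarrow> d \<in> set zs \<Longrightarrow> \<not> (c < a \<and> b < d)" for zs
      unfolding sorted_wrt_iff_nth_less using that by (meson nth_mem less_trans)
    show "sorted_wrt (\<lambda>c d. \<not> (c < a \<and> b < d)) ys"
    proof (cases "a = 1 \<or> b = n")
      case True
      then have "\<not> (c < a \<and> b < d)" if "c \<in> set ys" "d \<in> set ys" for c d
        using that range[of c] range[of d] by auto
      then show ?thesis
        by (rule free)
    next
      case False
      then have inner: "1 < a" "b < n"
        using range[of a] range[of b] by auto
      \<comment> \<open>Since \<open>a\<close> differs from \<open>1\<close>, the cut is proper:
        \<open>1\<close> opens \<open>u\<close> and \<open>a\<close> opens \<open>v\<close>.\<close>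
      obtain u' v' where u: "u = 1 # u'" "v = a # v'"
      proof -
        have "u \<noteq> []"
          using uv False by auto
        moreover have "v \<noteq> []"
          using uv False by auto
        ultimately show thesis
          using that uv by (auto simp: neq_Nil_conv)
      qed
      then have "X @ n # Y = u' @ a # v'"
        using uv(1) by simp
      then consider
          t where "X = u' @ t" "t @ n # Y = a # v'"
        | t where "u' = X @ t" "n # Y = t @ a # v'"
        by (auto simp: append_eq_append_conv2)
      then show ?thesis
      proof cases
        case 1
        then obtain t' where t': "X = u' @ a # t'" "v' = t' @ n # Y"
          using inner ab by (auto simp: append_eq_Cons_conv)
        then obtain s where s: "t' = b # s" "ys = s @ n # Y @ 1 # u'"
          using uv(2) u inner by (cases t') auto
        have "X = u' @ a # b # s"
          using t'(1) s(1) by simp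
        then have su: "(\<forall>c\<in>set s. a < c) \<and> (\<forall>d\<in>set u'. d < b)"
          using R ab unfolding tame_ascents_def by blast
        \<comment> \<open>Entries of \<open>s\<close> are too large for \<open>c\<close>, those of
          \<open>u'\<close> too small for \<open>d\<close>, and in the decreasing \<open>Y\<close>
          no smaller entry precedes a larger one.\<close>
        have "sorted_wrt (\<lambda>c d. \<not> (c < a \<and> b < d)) s"
          "sorted_wrt (\<lambda>c d. \<not> (c < a \<and> b < d)) u'"
          by (rule free, use su in force)+
        moreover have "sorted_wrt (\<lambda>c d. \<not> (c < a \<and> b < d)) Y"
          using R ab by (auto elim!: sorted_wrt_mono_rel[rotated])
        ultimately show ?thesis
          using su inner ab s(2) by (auto simp: sorted_wrt_append not_less less_imp_le)
      next
        case 2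
        then obtain t' where "Y = t' @ a # v'"
          using inner ab by (auto simp: Cons_eq_append_conv)
        \<comment> \<open>If \<open>v'\<close> were empty, the word would wrap around and
          \<open>b\<close> would be \<open>1\<close>, against \<open>1 < a < b\<close>.\<close>
        moreover have "v' = b # tl v'"
          using uv(2) u inner ab by (cases v') auto
        ultimately show ?thesis
          using R ab by (metis list.set_intros(1) not_less_iff_gr_or_eq sorted_wrt.simps(2) sorted_wrt_append)
      qed
    qed
  qed
qed

section \<open>Counting\<close>

text \<open>In an avoiding class the part after \<open>n\<close> decreases, hence is forced by the
  values that \<open>X\<close> omits; so \<open>X\<close> alone parametrises the class.\<close>

definition normal_form :: "nat \<Rightarrow> nat list \<Rightarrow> nat list" where
  "normal_form n X = 1 # X @ n # rev (sorted_list_of_set ({2..n-1} - set X))"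

lemma normal_form_avoids_iff:
  assumes "n \<ge> 2" "distinct X" "set X \<subseteq> {2..n-1}"
  shows "\<not> cyc_contains_23_1_4 (cyc_class (normal_form n X)) \<longleftrightarrow> tame_ascents X"
proof -
  let ?Y = "rev (sorted_list_of_set ({2..n-1} - set X))"
  have "sorted_wrt (>) ?Y"
    by (simp add: sorted_wrt_rev)
  moreover have "1 < x \<and> x < n" if "x \<in> set X \<union> set ?Y" for x
  proof -
    have "x \<in> {2..n-1}"
      using that assms(3) by auto
    then show ?thesis
      using assms(1) by auto
  qed
  moreover have "distinct (X @ ?Y)" "1 < n"
    using assms by auto
  ultimately show ?thesis
    unfolding normal_form_def using cyc_avoids_normal_form_iff by blast
qed

lemma normal_form_in_perms:
  assumes "n \<ge> 2" "distinct X" "set X \<subseteq> {2..n-1}"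
  shows "normal_form n X \<in> perms n"
proof -
  have "set (normal_form n X) = {1, n} \<union> {2..n-1}"
    using assms(3) by (auto simp: normal_form_def)
  also have "\<dots> = {1..n}"
    using assms(1) by auto
  finally have "set (normal_form n X) = {1..n}" .
  moreover have "n \<notin> set X" "1 \<notin> set X" "n \<notin> {2..n-1}"
    using assms(1,3) by auto
  then have "distinct (normal_form n X)"
    using assms(1,2) by (simp add: normal_form_def)
  ultimately show ?thesis
    by (simp add: perms_def)
qed

lemma Av_eq_normal_form_image:
  assumes "n \<ge> 2"
  shows "Av_23_1_4 n = (\<lambda>X. cyc_class (normal_form n X)) ` (\<Union>T\<in>Pow {2..n-1}. tame_words T)"
proof (intro equalityI subsetI)
  fix C assume C: "C \<in> Av_23_1_4 n"
  then obtain xs where xs: "distinct xs" "set xs = {1..n}" "C = cyc_class xs"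
    by (auto simp: Av_23_1_4_def cyclic_perms_def perms_def)
  then obtain u v where uv: "xs = u @ 1 # v"
    using assms split_list[of 1 xs] by auto
  have "n \<in> set (v @ u)"
  proof -
    have "n \<in> set xs" "n \<noteq> 1"
      using xs(2) assms by auto
    then show ?thesis
      using uv by auto
  qed
  then obtain X Y where XY: "v @ u = X @ n # Y"
    using split_list by metis
  have C_eq: "C = cyc_class (1 # X @ n # Y)"
    using xs(3) uv cyc_class_append_commute[of "1 # v" u] XY by simp
  have dist: "distinct (1 # X @ n # Y)"
    unfolding XY[symmetric] using xs(1) uv by auto
  have "set (1 # X @ n # Y) = {1..n}"
    unfolding xs(2)[symmetric] XY[symmetric] uv by auto
  then have "set X \<union> set Y = {1..n} - {1, n}"
    using dist by force
  also have "\<dots> = {2..n-1}"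
    by auto
  finally have sets: "set X \<union> set Y = {2..n-1}" .
  have "\<not> cyc_contains_23_1_4 (cyc_class (1 # X @ n # Y))"
    using C C_eq by (simp add: Av_23_1_4_def)
  then have R: "tame_ascents X \<and> sorted_wrt (>) Y"
    by (subst (asm) cyc_avoids_normal_form_iff) (use dist sets assms in auto)
  have "set Y = {2..n-1} - set X"
    using dist sets by auto
  then have "Y = rev (sorted_list_of_set ({2..n-1} - set X))"
    using R decreasing_unique[of Y] by simp
  then have "C = cyc_class (normal_form n X)"
    using C_eq by (simp add: normal_form_def)
  moreover have "X \<in> tame_words (set X)" "set X \<in> Pow {2..n-1}"
    using R dist sets by (auto simp: tame_words_def)
  ultimately show "C \<in> (\<lambda>X. cyc_class (normal_form n X)) ` (\<Union>T\<in>Pow {2..n-1}. tame_words T)"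
    by blast
next
  fix C assume "C \<in> (\<lambda>X. cyc_class (normal_form n X)) ` (\<Union>T\<in>Pow {2..n-1}. tame_words T)"
  then obtain X where "C = cyc_class (normal_form n X)" "distinct X" "set X \<subseteq> {2..n-1}" "tame_ascents X"
    by (auto simp: tame_words_def)
  then show "C \<in> Av_23_1_4 n"
    using assms normal_form_in_perms normal_form_avoids_iff
    by (auto simp: Av_23_1_4_def cyclic_perms_def)
qed

text \<open>The leading \<open>1\<close> pins down the rotation, and the single occurrence of
  \<open>n\<close> marks where \<open>X\<close> ends.\<close>

lemma inj_on_normal_form:
  assumes "n \<ge> 2"
  shows "inj_on (\<lambda>X. cyc_class (normal_form n X)) (\<Union>T\<in>Pow {2..n-1}. tame_words T)"
proof (rule inj_onI)
  fix X X' assume mem: "X \<in> (\<Union>T\<in>Pow {2..n-1}. tame_words T)" "X' \<in> (\<Union>T\<in>Pow {2..n-1}. tame_words T)"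
    and eq: "cyc_class (normal_form n X) = cyc_class (normal_form n X')"
  have X: "distinct X" "set X \<subseteq> {2..n-1}"
    using mem by (auto simp: tame_words_def)
  have "distinct (normal_form n X)"
    using normal_form_in_perms[OF assms X] by (simp add: perms_def)
  then have "X @ n # rev (sorted_list_of_set ({2..n-1} - set X)) =
      X' @ n # rev (sorted_list_of_set ({2..n-1} - set X'))"
    using eq unfolding normal_form_def by (rule cyc_class_Cons_inject)
  moreover have "n \<notin> set X" "n \<notin> set (rev (sorted_list_of_set ({2..n-1} - set X)))"
    using X(2) assms by auto
  ultimately show "X = X'"
    using append_Cons_eq_iff by metis
qed

lemma sum_Pow_card:
  fixes f :: "nat \<Rightarrow> nat"
  assumes "finite A"
  shows "(\<Sum>T\<in>Pow A. f (card T)) = (\<Sum>i = 0..card A. (card A choose i) * f i)"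
proof -
  have "(\<Sum>T\<in>Pow A. f (card T)) = (\<Sum>i\<in>{0..card A}. \<Sum>T | T \<in> Pow A \<and> card T = i. f (card T))"
    using assms by (intro sum.group[symmetric]) (auto intro: card_mono)
  also have "\<dots> = (\<Sum>i = 0..card A. (card A choose i) * f i)"
    using assms by (intro sum.cong) (auto simp: n_subsets)
  finally show ?thesis .
qed

theorem theorem5p12:
  fixes n :: nat
  assumes "n \<ge> 2"
  shows "card (Av_23_1_4 n) = (\<Sum>i = 0..n-2. (n - 2 choose i) * A_sm i)"
proof -
  have "card (Av_23_1_4 n) = card (\<Union>T\<in>Pow {2..n-1}. tame_words T)"
    unfolding Av_eq_normal_form_image[OF assms] by (rule card_image[OF inj_on_normal_form[OF assms]])
  \<comment> \<open>A word determines its set of letters \<open>T\<close>, so the union is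
    disjoint.\<close>
  also have "\<dots> = (\<Sum>T\<in>Pow {2..n-1}. card (tame_words T))"
  proof (rule card_UN_disjoint)
    show "\<forall>T\<in>Pow {2..n-1}. finite (tame_words T)"
      by (auto intro: finite_tame_words finite_subset)
  qed (auto simp: tame_words_def)
  also have "\<dots> = (\<Sum>T\<in>Pow {2..n-1}. A_sm (card T))"
    by (intro sum.cong refl card_tame_words) (auto intro: finite_subset)
  also have "\<dots> = (\<Sum>i = 0..card {2..n-1}. (card {2..n-1} choose i) * A_sm i)"
    by (rule sum_Pow_card) simp
  also have "card {2..n-1} = n - 2"
    using assms by simp
  finally show ?thesis .
qed

end
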